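(* Let $n \geq 1$ be an integer and let $f: \mathbb{R} \rightarrow \mathbb{R}$ be a function. If the composition operator $C_f$, $C_f(g) = f \circ g$, maps the space $\mathcal{B}_n(\mathbb{R})$ of real-valued functions of Baire class $n$ on $\mathbb{R}$ into itself, then $C_f : \mathcal{B}_n(\mathbb{R}) \to \mathcal{B}_n(\mathbb{R})$ is automatically continuous with respect to pointwise convergence; that is, whenever $(g_k)_{k \in \mathbb{N}}$ is a sequence in $\mathcal{B}_n(\mathbb{R})$ converging pointwise on $\mathbb{R}$ to some $g \in \mathcal{B}_n(\mathbb{R})$, the sequence $(C_f(g_k))_{k\in\mathbb{N}}$ converges pointwise on $\mathbb{R}$ to $C_f(g)$.
   Context: For a Polish space $X$, $\mathcal{B}_0(X) = C(X)$ is the set of continuous functions $X \to \mathbb{R}$, and for $n \geq 1$, $\mathcal{B}_n(X)$ is the set of functions $g: X \to \mathbb{R}$ (functions of Baire class $n$) for which there is a sequence $(g_k)$ in $\mathcal{B}_{n-1}(X)$ with $\lim_{k \to \infty} g_k(x) = g(x)$ for every $x \in X$. For $f: \mathbb{R} \to \mathbb{R}$, the (left) composition operator $C_f$ sends $g$ to $f \circ g$. *)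

theory Defs
  imports "HOL-Analysis.Analysis"
begin

primrec baire_class :: "nat \<Rightarrow> ('a::topological_space \<Rightarrow> real) set" where
  "baire_class 0 = {g. continuous_on UNIV g}"
| "baire_class (Suc n) =
     {g. \<exists>h :: nat \<Rightarrow> 'a \<Rightarrow> real.
           (\<forall>k. h k \<in> baire_class n) \<and> (\<forall>x. (\<lambda>k. h k x) \<longlonglongrightarrow> g x)}"

definition comp_operator :: "(real \<Rightarrow> real) \<Rightarrow> ('a \<Rightarrow> real) \<Rightarrow> ('a \<Rightarrow> real)" where
  "comp_operator f g = f \<circ> g"

end

theory Submission
  imports Defs
begin

text \<open>
  The hypothesis forces \<open>f\<close> to be continuous, which makes the conclusion immediate. Suppose that \<open>f\<close>
  is discontinuous at \<open>a\<close>, and choose \<open>y\<^sub>k \<rightarrow> a\<close> with \<open>f y\<^sub>k\<close> bounded away from \<open>f a\<close>. For disjoint sets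
  \<open>A\<^sub>k\<close> whose indicators are of class \<open>n\<close>, the function with value \<open>y\<^sub>k\<close> on \<open>A\<^sub>k\<close> and \<open>a\<close> elsewhere is a
  uniformly convergent series of functions of class \<open>n\<close>, hence of class \<open>n\<close>; composing with \<open>f\<close> and
  then with a continuous function gives the indicator of \<open>\<Union>\<^sub>k A\<^sub>k\<close>. So the sets whose indicator is of
  class \<open>n\<close> form a \<open>\<sigma>\<close>-algebra, which contains all Borel sets. But a diagonal argument with a Borel
  measurable universal function for class \<open>n\<close> produces a Borel set whose indicator is not of class \<open>n\<close>.
\<close>

section \<open>Closure properties of the Baire classes\<close>

text \<open>A continuous outer function commutes with pointwise limits, so the claim passes from one
  class to the next. Two arguments cover sums and maxima.\<close>

lemma baire_class_compose2:
  fixes \<phi> :: "real \<times> real \<Rightarrow> real"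
  assumes "continuous_on UNIV \<phi>" "g \<in> baire_class n" "h \<in> baire_class n"
  shows "(\<lambda>x. \<phi> (g x, h x)) \<in> baire_class n"
  using assms(2,3)
proof (induction n arbitrary: g h)
  case 0
  then have "continuous_on UNIV (\<lambda>x. (g x, h x))"
    by (auto intro!: continuous_intros)
  from continuous_on_compose2[OF assms(1) this] show ?case by simp
next
  case (Suc n)
  from Suc.prems obtain G H
    where "\<And>k. G k \<in> baire_class n" and G: "\<And>x. (\<lambda>k. G k x) \<longlonglongrightarrow> g x"
      and "\<And>k. H k \<in> baire_class n" and H: "\<And>x. (\<lambda>k. H k x) \<longlonglongrightarrow> h x"
    by auto
  then have "\<And>k. (\<lambda>x. \<phi> (G k x, H k x)) \<in> baire_class n"
    using Suc.IH by blast
  moreover have "(\<lambda>k. \<phi> (G k x, H k x)) \<longlonglongrightarrow> \<phi> (g x, h x)" for x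
    by (rule continuous_on_tendsto_compose[OF assms(1) tendsto_Pair[OF G H]]) auto
  ultimately show ?case
    by (auto intro!: exI[of _ "\<lambda>k x. \<phi> (G k x, H k x)"])
qed

lemma baire_class_compose:
  fixes \<phi> :: "real \<Rightarrow> real"
  assumes "continuous_on UNIV \<phi>" "g \<in> baire_class n"
  shows "(\<lambda>x. \<phi> (g x)) \<in> baire_class n"
proof -
  have "continuous_on UNIV (\<lambda>p :: real \<times> real. \<phi> (fst p))"
    by (rule continuous_on_compose2[OF assms(1)]) (auto intro!: continuous_intros)
  from baire_class_compose2[OF this assms(2) assms(2)] show ?thesis by simp
qed

lemma baire_class_const: "(\<lambda>x. c) \<in> baire_class n"
  by (induction n) (auto intro!: exI[of _ "\<lambda>k x. c"])

lemma baire_class_add: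
  assumes "g \<in> baire_class n" "h \<in> baire_class n"
  shows "(\<lambda>x. g x + h x) \<in> baire_class n"
proof -
  have "continuous_on UNIV (\<lambda>p :: real \<times> real. fst p + snd p)"
    by (intro continuous_intros)
  from baire_class_compose2[OF this assms] show ?thesis by simp
qed

lemma baire_class_sum:
  assumes "\<And>i. i \<in> I \<Longrightarrow> h i \<in> baire_class n"
  shows "(\<lambda>x. \<Sum>i\<in>I. h i x) \<in> baire_class n"
  using assms
  by (induction I rule: infinite_finite_induct) (auto intro: baire_class_const baire_class_add)

lemma continuous_imp_baire_class:
  assumes "continuous_on UNIV g"
  shows "g \<in> baire_class n"
  by (induction n) (use assms in auto)

text \<open>Diagonal summation: the i-th approximant of the series adds the i-th approximants of its
  first i terms. The summable bound \<open>M\<close> justifies exchanging limit and sum.\<close>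

lemma baire_class_suminf:
  assumes h: "\<And>k. h k \<in> baire_class (Suc n)"
    and bound: "\<And>k x. \<bar>h k x\<bar> \<le> M k" and M: "summable M"
  shows "(\<lambda>x. \<Sum>k. h k x) \<in> baire_class (Suc n)"
proof -
  have "\<forall>k. \<exists>u. (\<forall>i. u i \<in> baire_class n) \<and> (\<forall>x. (\<lambda>i. u i x) \<longlonglongrightarrow> h k x)"
    using h by simp
  then obtain u where u: "\<And>k i. u k i \<in> baire_class n" "\<And>k x. (\<lambda>i. u k i x) \<longlonglongrightarrow> h k x"
    by metis
  \<comment> \<open>Clipping to [-\<open>M k\<close>, \<open>M k\<close>] keeps the class, by
    continuity, and keeps the limit, because \<open>h k\<close> already obeys this bound.\<close>
  define v where "v k i x = max (- M k) (min (M k) (u k i x))" for k i x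
  have M0: "0 \<le> M k" for k
    using bound[of k undefined] by linarith
  have v_bound: "\<bar>v k i x\<bar> \<le> M k" for k i x
    using M0[of k] by (auto simp: v_def)
  have v: "v k i \<in> baire_class n" for k i
    unfolding v_def by (rule baire_class_compose[OF _ u(1)]) (intro continuous_intros)
  have v_lim: "(\<lambda>i. v k i x) \<longlonglongrightarrow> h k x" for k x
  proof -
    have "(\<lambda>i. v k i x) \<longlonglongrightarrow> max (- M k) (min (M k) (h k x))"
      unfolding v_def by (intro tendsto_intros u)
    also have "max (- M k) (min (M k) (h k x)) = h k x"
      using bound[of k x] by auto
    finally show ?thesis .
  qed
  have "(\<lambda>i. \<Sum>k<i. v k i x) \<longlonglongrightarrow> (\<Sum>k. h k x)" for x
  proof -
    \<comment> \<open>Padding with zeros turns the growing finite sums into full series dominated by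
      \<open>M\<close>, as Tannery's theorem requires.\<close>
    define w where "w k i = (if k < i then v k i x else 0)" for k i
    have "(\<lambda>i. w k i) \<longlonglongrightarrow> h k x" for k
      by (rule Lim_transform_eventually[OF v_lim[of k x]])
        (auto simp: w_def intro: eventually_mono[OF eventually_gt_at_top[of k]])
    moreover have "\<forall>\<^sub>F (k, i) in at_top \<times>\<^sub>F at_top. norm (w k i) \<le> M k"
      using v_bound M0 by (auto simp: w_def intro!: always_eventually)
    ultimately have "(\<lambda>i. \<Sum>k. w k i) \<longlonglongrightarrow> (\<Sum>k. h k x)"
      using tannerys_theorem[of w "\<lambda>k. h k x" sequentially M] M by simp
    moreover have "(\<Sum>k. w k i) = (\<Sum>k<i. v k i x)" for i
      by (subst suminf_finite[of "{..<i}"]) (auto simp: w_def)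
    ultimately show ?thesis by simp
  qed
  moreover have "(\<lambda>x. \<Sum>k<i. v k i x) \<in> baire_class n" for i
    by (intro baire_class_sum v)
  ultimately show ?thesis
    by (auto intro!: exI[of _ "\<lambda>i x. \<Sum>k<i. v k i x"])
qed

text \<open>On \<open>U\<close> the distance to the closed complement is positive, so its multiples
  truncated at 1 eventually equal 1; off \<open>U\<close> they stay 0.\<close>

lemma indicator_open_baire_class:
  fixes U :: "'a :: metric_space set"
  assumes "open U"
  shows "indicator U \<in> baire_class (Suc n)"
\<comment> \<open>\<open>infdist\<close> to the empty set is 0, so the distance argument requires a
  nonempty complement.\<close>
proof (cases "U = UNIV")
  case True
  then show ?thesis
    using baire_class_const[of 1 "Suc n"] by (simp add: indicator_def del: baire_class.simps)
next
  case False
  define h where "h k x = min 1 (real k * infdist x (- U))" for k x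
  have "h k \<in> baire_class n" for k
    unfolding h_def by (intro continuous_imp_baire_class continuous_intros)
  moreover have "(\<lambda>k. h k x) \<longlonglongrightarrow> indicator U x" for x
  proof (cases "x \<in> U")
    case True
    then have pos: "infdist x (- U) > 0"
      using assms False by (intro infdist_pos_not_in_closed) auto
    obtain N where N: "1 < real N * infdist x (- U)"
      using ex_less_of_nat_mult[OF pos] by auto
    have "h k x = 1" if "k \<ge> N" for k
    proof -
      have "real N * infdist x (- U) \<le> real k * infdist x (- U)"
        using that pos by (intro mult_right_mono) auto
      with N show ?thesis by (simp add: h_def)
    qed
    then show ?thesis
      using True by (intro tendsto_eventually) (auto simp: eventually_sequentially)
  next
    case False
    then have "h k x = 0" for k
      by (simp add: h_def)
    with False show ?thesis by simp
  qed
  ultimately show ?thesis by auto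
qed

text \<open>Complement and union act on indicators through the continuous maps 1 - t and
  maximum.\<close>

lemma algebra_indicator_baire_class: "algebra UNIV {A. indicator A \<in> baire_class n}"
  unfolding algebra_iff_Un
proof (intro conjI ballI)
  show "{} \<in> {A :: 'a set. indicator A \<in> baire_class n}"
    using baire_class_const[of 0 n] by (simp add: indicator_def[abs_def])
next
  fix A :: "'a set" assume "A \<in> {A. indicator A \<in> baire_class n}"
  then have "(\<lambda>x. 1 - indicator A x) \<in> baire_class n"
    by (intro baire_class_compose[of "\<lambda>t. 1 - t"] continuous_intros) auto
  also have "(\<lambda>x. 1 - indicator A x) = (indicator (UNIV - A) :: 'a \<Rightarrow> real)"
    by (auto simp: fun_eq_iff indicator_def)
  finally show "UNIV - A \<in> {A. indicator A \<in> baire_class n}" by simp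
next
  fix A B :: "'a set"
  assume "A \<in> {A. indicator A \<in> baire_class n}" "B \<in> {A. indicator A \<in> baire_class n}"
  moreover have "continuous_on UNIV (\<lambda>p :: real \<times> real. max (fst p) (snd p))"
    by (intro continuous_intros)
  ultimately have "(\<lambda>x. max (indicator A x) (indicator B x)) \<in> baire_class n"
    using baire_class_compose2[of "\<lambda>p. max (fst p) (snd p)" "indicator A" n "indicator B"]
    by simp
  also have "(\<lambda>x. max (indicator A x) (indicator B x)) = (indicator (A \<union> B) :: 'a \<Rightarrow> real)"
    by (auto simp: fun_eq_iff indicator_def)
  finally show "A \<union> B \<in> {A. indicator A \<in> baire_class n}" by simp
qed auto

section \<open>Universal functions\<close>

text \<open>This lets one real parameter store countably many independent yes/no answers that can be
  read off in a Borel way.\<close>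

lemma ex_measurable_binary_digits:
  "\<exists>bit :: nat \<Rightarrow> real \<Rightarrow> bool.
     (\<forall>j. Measurable.pred borel (bit j)) \<and> (\<forall>b. \<exists>c. \<forall>j. bit j c = b j)"
proof -
  define bit :: "nat \<Rightarrow> real \<Rightarrow> bool" where "bit j c = odd \<lfloor>4 ^ Suc j * c\<rfloor>" for j c
  \<comment> \<open>Digits 0 and 1 in base 4 leave no ambiguity from infinitely repeated maximal digits.\<close>
  define C :: "(nat \<Rightarrow> bool) \<Rightarrow> real" where "C b = (\<Sum>i. of_bool (b i) * (1 / 4) ^ Suc i)" for b
  have geo: "(\<lambda>i. (1 / 4 :: real) ^ Suc i) sums (1 / 3)"
    using sums_mult[OF geometric_sums[of "1 / 4 :: real"], of "1 / 4"] by simp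
  have summ: "summable (\<lambda>i. of_bool (b i) * (1 / 4 :: real) ^ Suc i)" for b
    by (rule summable_comparison_test'[OF sums_summable[OF geo], of 0]) auto
  have C_nonneg: "0 \<le> C b" for b
    unfolding C_def by (intro suminf_nonneg summ) auto
  have C_less: "C b < 1" for b
  proof -
    have "C b \<le> (\<Sum>i. (1 / 4) ^ Suc i)"
      unfolding C_def by (intro suminf_le summ sums_summable[OF geo]) auto
    then show ?thesis using sums_unique[OF geo] by simp
  qed
  have C_shift: "4 * C b = of_bool (b 0) + C (\<lambda>i. b (Suc i))" for b
  proof -
    have "C b = of_bool (b 0) / 4 + (\<Sum>i. of_bool (b (Suc i)) * (1 / 4) ^ Suc (Suc i))"
      unfolding C_def using suminf_split_head[OF summ[of b]] by simp
    also have "(\<Sum>i. of_bool (b (Suc i)) * (1 / 4 :: real) ^ Suc (Suc i))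
        = (1 / 4) * C (\<lambda>i. b (Suc i))"
      unfolding C_def by (subst suminf_mult[symmetric, OF summ]) (simp add: mult_ac)
    finally show ?thesis by simp
  qed
  \<comment> \<open>Multiplying by 4^j moves the first j digits into the integer part and leaves a
    tail in [0,1). One more factor 4 makes the parity of the floor equal to the digit
    \<open>b j\<close>.\<close>
  have C_pow: "\<exists>m :: int. 4 ^ j * C b = of_int m + C (\<lambda>i. b (i + j))" for j b
  proof (induction j)
    case 0
    show ?case by (auto intro!: exI[of _ 0])
  next
    case (Suc j)
    then obtain m :: int where "4 ^ j * C b = of_int m + C (\<lambda>i. b (i + j))" by blast
    then have "4 ^ Suc j * C b = of_int (4 * m + of_bool (b j)) + C (\<lambda>i. b (i + Suc j))"
      using C_shift[of "\<lambda>i. b (i + j)"] by simp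
    then show ?case by blast
  qed
  have "bit j (C b) = b j" for j b
  proof -
    obtain m :: int where "4 ^ j * C b = of_int m + C (\<lambda>i. b (i + j))"
      using C_pow by blast
    then have "4 ^ Suc j * C b = of_int (4 * m + of_bool (b j)) + C (\<lambda>i. b (i + Suc j))"
      using C_shift[of "\<lambda>i. b (i + j)"] by simp
    then have "\<lfloor>4 ^ Suc j * C b\<rfloor> = 4 * m + of_bool (b j)"
      using C_nonneg[of "\<lambda>i. b (i + Suc j)"] C_less[of "\<lambda>i. b (i + Suc j)"]
      by (intro floor_unique) auto
    then show ?thesis by (simp add: bit_def)
  qed
  moreover have "Measurable.pred borel (bit j)" for j
    unfolding bit_def by measurable
  ultimately show ?thesis by blast
qed

text \<open>A universal function needs one real to encode a sequence of reals: values of a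
  continuous function in the base case, parameters of approximants in the induction step.\<close>

lemma ex_measurable_sequence_coding:
  "\<exists>d :: nat \<Rightarrow> real \<Rightarrow> real.
     (\<forall>k. d k \<in> borel_measurable borel) \<and> (\<forall>s. \<exists>c. \<forall>k. d k c = s k)"
proof -
  obtain bit :: "nat \<Rightarrow> real \<Rightarrow> bool" where [measurable]: "\<And>j. Measurable.pred borel (bit j)"
    and bit: "\<And>b. \<exists>c. \<forall>j. bit j c = b j"
    using ex_measurable_binary_digits by blast
  \<comment> \<open>A real number is coded by the set of rationals below it.\<close>
  define r :: "nat \<Rightarrow> real" where "r j = of_rat (from_nat j)" for j
  \<comment> \<open>In \<open>ereal\<close> the supremum exists for every \<open>c\<close>, even if
    the coded set is empty or unbounded, so \<open>d k\<close> is total and Borel as a countable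
    supremum.\<close>
  define d where
    "d k c = real_of_ereal (SUP j. if bit (prod_encode (k, j)) c then ereal (r j) else -\<infinity>)" for k c
  have "d k \<in> borel_measurable borel" for k
    unfolding d_def by measurable
  moreover have "\<exists>c. \<forall>k. d k c = s k" for s
  proof -
    obtain c where c: "\<And>i. bit i c = (case prod_decode i of (k, j) \<Rightarrow> r j < s k)"
      using bit[of "\<lambda>i. case prod_decode i of (k, j) \<Rightarrow> r j < s k"] by blast
    have "(SUP j. if bit (prod_encode (k, j)) c then ereal (r j) else -\<infinity>) = ereal (s k)" for k
    proof (rule SUP_eqI)
      show "(if bit (prod_encode (k, j)) c then ereal (r j) else -\<infinity>) \<le> ereal (s k)" for j
        by (auto simp: c)
    next
      fix y :: ereal
      assume y: "\<And>j. j \<in> UNIV \<Longrightarrow> (if bit (prod_encode (k, j)) c then ereal (r j) else -\<infinity>) \<le> y"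
      show "ereal (s k) \<le> y"
      proof (rule ccontr)
        assume "\<not> ereal (s k) \<le> y"
        then obtain t where t: "y < ereal t" "ereal t < ereal (s k)"
          using ereal_dense2[of y "ereal (s k)"] by (auto simp: not_le)
        then obtain q where q: "t < of_rat q" "of_rat q < s k"
          using of_rat_dense[of t "s k"] by auto
        then have "ereal (of_rat q) \<le> y"
          using y[of "to_nat q"] by (simp add: c r_def)
        with t(1) q(1) show False
          by (meson ereal_less_eq(3) less_imp_le not_less order_trans)
      qed
    qed
    then have "\<forall>k. d k c = s k"
      unfolding d_def by (simp only: real_of_ereal.simps simp_thms)
    then show ?thesis by blast
  qed
  ultimately show ?thesis by blast
qed

text \<open>
  Measurability is stated along the curves \<open>x \<mapsto> (u x, x)\<close>, because this form passes through the
  induction and contains the diagonal.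
\<close>

lemma ex_universal_function_baire_class:
  "\<exists>U :: real \<Rightarrow> real \<Rightarrow> real.
     (\<forall>u \<in> borel_measurable borel. (\<lambda>x. U (u x) x) \<in> borel_measurable borel) \<and>
     (\<forall>g \<in> baire_class n. \<exists>c. U c = g)"
proof -
  obtain d :: "nat \<Rightarrow> real \<Rightarrow> real" where d_meas: "\<And>k. d k \<in> borel_measurable borel"
    and d: "\<And>s. \<exists>c. \<forall>k. d k c = s k"
    using ex_measurable_sequence_coding by blast
  note [measurable] = d_meas
  show ?thesis
  proof (induction n)
    case 0
    \<comment> \<open>Here \<open>c\<close> lists the values of a continuous function at the
      fractions m/(k+1); those with m the floor of (k+1)x tend to x. Where the sequence diverges,
      \<open>lim\<close> takes a default value and measurability persists.\<close>
    define U where "U c x = lim (\<lambda>k. d (to_nat (\<lfloor>real (Suc k) * x\<rfloor>, k)) c)" for c x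
    have "(\<lambda>x. U (u x) x) \<in> borel_measurable borel"
      if [measurable]: "u \<in> borel_measurable borel" for u
    proof -
      have "(\<lambda>x. d (to_nat (\<lfloor>real (Suc k) * x\<rfloor>, k)) (u x)) \<in> borel_measurable borel" for k
        \<comment> \<open>The index varies with x only through an integer, so a countable case split
          preserves measurability.\<close>
        by (rule measurable_compose_countable
            [of "\<lambda>m x. d (to_nat (m, k)) (u x)" _ _ "\<lambda>x. \<lfloor>real (Suc k) * x\<rfloor>"]) measurable
      then show ?thesis
        unfolding U_def by (rule borel_measurable_lim_metric)
    qed
    moreover have "\<exists>c. U c = g" if "g \<in> baire_class 0" for g
    proof -
      obtain c where c: "\<And>i. d i c = (case from_nat i of (m :: int, k :: nat) \<Rightarrow> g (m / real (Suc k)))"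
        using d[of "\<lambda>i. case from_nat i of (m :: int, k :: nat) \<Rightarrow> g (m / real (Suc k))"] by blast
      have "U c x = g x" for x
      proof -
        have "\<bar>\<lfloor>real (Suc k) * x\<rfloor> / real (Suc k) - x\<bar> \<le> inverse (real (Suc k))" for k
        proof -
          have "\<bar>\<lfloor>real (Suc k) * x\<rfloor> - real (Suc k) * x\<bar> \<le> 1"
            by linarith
          then have "\<bar>\<lfloor>real (Suc k) * x\<rfloor> - real (Suc k) * x\<bar> / real (Suc k) \<le> 1 / real (Suc k)"
            by (intro divide_right_mono) auto
          also have "\<bar>\<lfloor>real (Suc k) * x\<rfloor> - real (Suc k) * x\<bar> / real (Suc k)
              = \<bar>(\<lfloor>real (Suc k) * x\<rfloor> - real (Suc k) * x) / real (Suc k)\<bar>"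
            by (simp add: abs_divide)
          also have "(\<lfloor>real (Suc k) * x\<rfloor> - real (Suc k) * x) / real (Suc k)
              = \<lfloor>real (Suc k) * x\<rfloor> / real (Suc k) - x"
            by (simp only: diff_divide_distrib) simp
          finally show ?thesis by (simp add: inverse_eq_divide)
        qed
        then have "(\<lambda>k. \<lfloor>real (Suc k) * x\<rfloor> / real (Suc k) - x) \<longlonglongrightarrow> 0"
          by (intro Lim_null_comparison[OF _ LIMSEQ_inverse_real_of_nat] always_eventually allI)
            (simp only: real_norm_def)
        then have "(\<lambda>k. \<lfloor>real (Suc k) * x\<rfloor> / real (Suc k)) \<longlonglongrightarrow> x"
          by (rule LIM_zero_cancel)
        moreover have "continuous_on UNIV g" using that by simp
        ultimately have "(\<lambda>k. g (\<lfloor>real (Suc k) * x\<rfloor> / real (Suc k))) \<longlonglongrightarrow> g x"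
          by (intro continuous_on_tendsto_compose[of UNIV g]) auto
        then show ?thesis
          unfolding U_def c by (intro limI) simp
      qed
      then show ?thesis by blast
    qed
    ultimately show ?case by blast
  next
    case (Suc n)
    then obtain V :: "real \<Rightarrow> real \<Rightarrow> real"
      where V: "\<And>u. u \<in> borel_measurable borel \<Longrightarrow> (\<lambda>x. V (u x) x) \<in> borel_measurable borel"
        and V_univ: "\<And>g. g \<in> baire_class n \<Longrightarrow> \<exists>c. V c = g"
      by blast
    \<comment> \<open>Now \<open>c\<close> encodes a sequence of parameters for \<open>V\<close>.
      The curve form of the hypothesis applies with \<open>u\<close> replaced by \<open>d k\<close>
      after \<open>u\<close>.\<close>
    define U where "U c x = lim (\<lambda>k. V (d k c) x)" for c x
    have "(\<lambda>x. U (u x) x) \<in> borel_measurable borel"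
      if [measurable]: "u \<in> borel_measurable borel" for u
      unfolding U_def by (intro borel_measurable_lim_metric V) measurable
    moreover have "\<exists>c. U c = g" if "g \<in> baire_class (Suc n)" for g
    proof -
      obtain h where h: "\<And>k. h k \<in> baire_class n" "\<And>x. (\<lambda>k. h k x) \<longlonglongrightarrow> g x"
        using \<open>g \<in> baire_class (Suc n)\<close> by auto
      obtain s where s: "\<And>k. V (s k) = h k"
        using V_univ[OF h(1)] by metis
      obtain c where "\<And>k. d k c = s k"
        using d by blast
      then have "U c = g"
        using h(2) by (auto simp: U_def s fun_eq_iff intro: limI)
      then show ?thesis by blast
    qed
    ultimately show ?case by blast
  qed
qed

lemma ex_borel_set_indicator_not_baire_class:
  "\<exists>A :: real set. A \<in> sets borel \<and> indicator A \<notin> baire_class n"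
proof -
  obtain U :: "real \<Rightarrow> real \<Rightarrow> real"
    where U: "\<And>u. u \<in> borel_measurable borel \<Longrightarrow> (\<lambda>x. U (u x) x) \<in> borel_measurable borel"
      and U_univ: "\<And>g. g \<in> baire_class n \<Longrightarrow> \<exists>c. U c = g"
    using ex_universal_function_baire_class[of n] by blast
  \<comment> \<open>If \<open>U c\<close> were the indicator of this set, \<open>U c c\<close> would
    be 1 exactly when it is at most 0.\<close>
  define A where "A = {x. U x x \<le> 0}"
  have [measurable]: "(\<lambda>x. U x x) \<in> borel_measurable borel"
    using U[of "\<lambda>x. x"] by simp
  have "{x \<in> space borel. U x x \<le> 0} \<in> sets borel"
    by measurable
  then have "A \<in> sets borel" by (simp add: A_def)
  moreover have "indicator A \<notin> baire_class n"
  proof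
    assume "indicator A \<in> baire_class n"
    then obtain c where "U c = indicator A" using U_univ by blast
    then have "U c c = indicator A c" by simp
    then show False by (cases "U c c \<le> 0") (auto simp: A_def)
  qed
  ultimately show ?thesis by blast
qed

section \<open>Continuity of the composition operator\<close>

lemma isCont_if_comp_operator_baire_class:
  fixes f :: "real \<Rightarrow> real"
  assumes f: "\<And>g :: real \<Rightarrow> real. g \<in> baire_class (Suc n) \<Longrightarrow> comp_operator f g \<in> baire_class (Suc n)"
  shows "isCont f a"
proof (rule ccontr)
  assume "\<not> isCont f a"
  then obtain \<epsilon> where "\<epsilon> > 0" and *: "\<And>\<delta>. \<delta> > 0 \<Longrightarrow> \<exists>y. dist y a < \<delta> \<and> \<epsilon> \<le> dist (f y) (f a)"
    unfolding isCont_def LIM_def by (meson not_less)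
  \<comment> \<open>The rate (1/2)^k supplies the summable bound for the series that defines
    \<open>g\<close>.\<close>
  have "\<forall>k. \<exists>y. dist y a < (1 / 2) ^ k \<and> \<epsilon> \<le> dist (f y) (f a)"
    using * by simp
  then obtain y where y: "\<And>k. dist (y k) a < (1 / 2) ^ k" "\<And>k. \<epsilon> \<le> dist (f (y k)) (f a)"
    by metis
  let ?D = "{A :: real set. indicator A \<in> baire_class (Suc n)}"
  have union: "(\<Union>k. A k) \<in> ?D" if A: "range A \<subseteq> ?D" "disjoint_family A" for A :: "nat \<Rightarrow> real set"
  proof -
    define g where "g x = a + (\<Sum>k. (y k - a) * indicator (A k) x)" for x
    have "(\<lambda>x. (y k - a) * indicator (A k) x) \<in> baire_class (Suc n)" for k
      using A(1) by (intro baire_class_compose[of "\<lambda>t. (y k - a) * t"] continuous_intros) auto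
    moreover have "\<bar>(y k - a) * indicator (A k) x\<bar> \<le> (1 / 2) ^ k" for k x
      using y(1)[of k] by (auto simp: indicator_def dist_real_def)
    ultimately have "(\<lambda>x. \<Sum>k. (y k - a) * indicator (A k) x) \<in> baire_class (Suc n)"
      by (rule baire_class_suminf) (simp add: summable_geometric)
    then have "g \<in> baire_class (Suc n)"
      unfolding g_def by (intro baire_class_add baire_class_const)
    then have "comp_operator f g \<in> baire_class (Suc n)" by (rule f)
    \<comment> \<open>The outer function is 0 at \<open>f a\<close> and 1 at every
      \<open>f (y k)\<close>, so it turns the composition into the indicator of the union.\<close>
    then have "(\<lambda>x. min 1 (dist (comp_operator f g x) (f a) / \<epsilon>)) \<in> baire_class (Suc n)"
      using \<open>\<epsilon> > 0\<close>
      by (intro baire_class_compose[of "\<lambda>t. min 1 (dist t (f a) / \<epsilon>)"] continuous_intros) auto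
    also have "(\<lambda>x. min 1 (dist (comp_operator f g x) (f a) / \<epsilon>)) = indicator (\<Union>k. A k)"
    proof
      fix x
      show "min 1 (dist (comp_operator f g x) (f a) / \<epsilon>) = indicator (\<Union>k. A k) x"
      proof (cases "x \<in> (\<Union>k. A k)")
        case True
        then obtain i where i: "x \<in> A i" by blast
        have "x \<notin> A k" if "k \<noteq> i" for k
          using that i A(2) by (auto simp: disjoint_family_on_def)
        then have "(\<Sum>k. (y k - a) * indicator (A k) x) = (\<Sum>k\<in>{i}. (y k - a) * indicator (A k) x)"
          by (intro suminf_finite) auto
        with i have "g x = y i" by (simp add: g_def)
        with True y(2)[of i] \<open>\<epsilon> > 0\<close> show ?thesis
          by (simp add: comp_operator_def)
      next
        case False
        then have "g x = a" by (simp add: g_def)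
        with False show ?thesis by (simp add: comp_operator_def)
      qed
    qed
    finally show ?thesis by simp
  qed
  \<comment> \<open>An algebra closed under countable disjoint unions is a sigma-algebra;
    disjointness is what gives \<open>g\<close> the single value \<open>y i\<close> on
    \<open>A i\<close>.\<close>
  then have "sigma_algebra UNIV ?D"
    using algebra_indicator_baire_class by (auto simp: sigma_algebra_disjoint_iff simp del: baire_class.simps)
  then have "sigma_sets UNIV {S :: real set. open S} \<subseteq> ?D"
    by (rule sigma_algebra.sigma_sets_subset)
      (auto intro: indicator_open_baire_class simp del: baire_class.simps)
  then have "sets (borel :: real measure) \<subseteq> ?D"
    by (simp add: borel_def)
  with ex_borel_set_indicator_not_baire_class[of "Suc n"] show False by blast
qed

theorem theorem3p1p14:
  fixes n :: nat and f :: "real \<Rightarrow> real"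
  assumes "n \<ge> 1"
    and "\<And>g :: real \<Rightarrow> real. g \<in> baire_class n \<Longrightarrow> comp_operator f g \<in> baire_class n"
  shows "\<forall>(G :: nat \<Rightarrow> real \<Rightarrow> real) (g :: real \<Rightarrow> real).
           (\<forall>k. G k \<in> baire_class n) \<longrightarrow> g \<in> baire_class n \<longrightarrow>
           (\<forall>x. (\<lambda>k. G k x) \<longlonglongrightarrow> g x) \<longrightarrow>
           (\<forall>x. (\<lambda>k. comp_operator f (G k) x) \<longlonglongrightarrow> comp_operator f g x)"
proof -
  obtain m where "n = Suc m"
    using assms(1) by (cases n) auto
  then have "isCont f a" for a
    using isCont_if_comp_operator_baire_class assms(2) by blast
  then show ?thesis
    by (auto simp: comp_operator_def intro: isCont_tendsto_compose)
qed

end
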